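(* Let $n\ge 1$ and let $A,B\subset\mathbb{R}^n$ be convex bodies. If for every fractional linear map $F$ on $\mathbb{R}^n$ that is admissible for $A$ and $B$ (i.e. $A,B\subset \mathrm{Dom}(F)$) one has $$\mathrm{Vol}(F(A))\le \mathrm{Vol}(F(B)),$$ then $A\subseteq B$.
   Context: A convex body in $\mathbb{R}^n$ is a compact convex set with non-empty interior. A fractional linear map on $\mathbb{R}^n$ is a map of the form $F(x)=\frac{Mx+b}{\langle x,c\rangle+d}$, where $M$ is a linear operator on $\mathbb{R}^n$, $b,c\in\mathbb{R}^n$, $d\in\mathbb{R}$, and the $(n+1)\times(n+1)$ matrix $\begin{pmatrix} M & b\\ c & d\end{pmatrix}$ is invertible. If $c=0$ the map is affine and $\mathrm{Dom}(F)=\mathbb{R}^n$. If $c\neq 0$, the map is undefined on the affine hyperplane $H=\{x:\langle x,c\rangle+d=0\}$, and $F$ is considered on one side of $H$, i.e. $\mathrm{Dom}(F)$ is one of the two open half-spaces bounded by $H$. The map $F$ is admissible for $A,B$ if $A,B\subset\mathrm{Dom}(F)$. $\mathrm{Vol}$ is Lebesgue measure on $\mathbb{R}^n$. *)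

theory Defs
  imports "HOL-Analysis.Analysis"
begin

definition convex_body :: "(real ^ 'n) set \<Rightarrow> bool" where
  "convex_body K \<longleftrightarrow> compact K \<and> convex K \<and> interior K \<noteq> {}"

text \<open>The square matrix of size \<open>n + 1\<close> with block rows \<open>(M, b)\<close> and \<open>(c, d)\<close>. Its rows and
  columns are indexed by \<open>'n option\<close>, with \<open>None\<close> as the additional last index.\<close>

definition block_matrix ::
  "real ^ 'n ^ 'n \<Rightarrow> real ^ 'n \<Rightarrow> real ^ 'n \<Rightarrow> real \<Rightarrow> real ^ ('n option) ^ ('n option)" where
  "block_matrix M b c d = (\<chi> i j.
     case i of
       Some k \<Rightarrow> (case j of Some l \<Rightarrow> M $ k $ l | None \<Rightarrow> b $ k)
     | None \<Rightarrow> (case j of Some l \<Rightarrow> c $ l | None \<Rightarrow> d))"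

definition frac_lin_domain :: "real ^ 'n \<Rightarrow> real \<Rightarrow> (real ^ 'n) set \<Rightarrow> bool" where
  "frac_lin_domain c d D \<longleftrightarrow>
     (if c = 0 then D = UNIV
      else D = {x. x \<bullet> c + d > 0} \<or> D = {x. x \<bullet> c + d < 0})"

text \<open>\<open>F\<close> is a fractional linear map with \<open>Dom(F) = D\<close>. The choice of the side of the hyperplane is
  part of the map, so the domain is a separate argument; the values of \<open>F\<close> outside \<open>D\<close> are
  irrelevant.\<close>

definition fractional_linear_map :: "(real ^ 'n) set \<Rightarrow> (real ^ 'n \<Rightarrow> real ^ 'n) \<Rightarrow> bool" where
  "fractional_linear_map D F \<longleftrightarrow>
     (\<exists>(M :: real ^ 'n ^ 'n) b c d.
        invertible (block_matrix M b c d) \<and> frac_lin_domain c d D \<and>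
        (\<forall>x\<in>D. F x = (1 / (x \<bullet> c + d)) *\<^sub>R (M *v x + b)))"

definition admissible :: "(real ^ 'n) set \<Rightarrow> (real ^ 'n) set \<Rightarrow> (real ^ 'n) set \<Rightarrow> bool" where
  "admissible D A B \<longleftrightarrow> A \<subseteq> D \<and> B \<subseteq> D"

end

theory Submission imports Defs begin

text \<open>If \<open>A\<close> is not contained in \<open>B\<close>, some direction \<open>a\<close> has a minimiser \<open>p\<close> over \<open>A\<close> such that
  \<open>B\<close> lies strictly above the supporting hyperplane of \<open>A\<close> at \<open>p\<close>. Let
  \<open>F\<^sub>e x = (x - p) / (a \<bullet> (x - p) + e)\<close>, whose hyperplane of poles tends to that supporting
  hyperplane as \<open>e\<close> decreases to \<open>0\<close>. Since \<open>F\<^sub>e (p + e (y - p)) = F\<^sub>1 y\<close>, convexity gives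
  \<open>F\<^sub>1(A) \<subseteq> F\<^sub>e(A)\<close>, so the volume of \<open>F\<^sub>e(A)\<close> stays away from \<open>0\<close>. On the other hand
  \<open>F\<^sub>e(B)\<close> is uniformly bounded and collapses onto the hyperplane \<open>{y. a \<bullet> y = 1}\<close>, so its volume
  tends to \<open>0\<close>.\<close>

text \<open>Projective map turning the height \<open>h = a \<bullet> (x - p)\<close> into
  \<open>h / (h + e)\<close>; injectivity and the collapse of \<open>B\<close> are both read off
  from this.\<close>

definition cone_map :: "real ^ 'n \<Rightarrow> real ^ 'n \<Rightarrow> real \<Rightarrow> real ^ 'n \<Rightarrow> real ^ 'n" where
  "cone_map a p e x = (1 / (a \<bullet> (x - p) + e)) *\<^sub>R (x - p)"

lemma sum_UNIV_option:
  fixes f :: "'a::finite option \<Rightarrow> 'b::comm_monoid_add"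
  shows "(\<Sum>j\<in>UNIV. f j) = f None + (\<Sum>k\<in>UNIV. f (Some k))"
  by (simp add: UNIV_option_conv sum.reindex)

text \<open>\<open>d - b \<bullet> c\<close> is the Schur complement of the identity block: a kernel
  vector \<open>(w, s)\<close> has \<open>w = - s b\<close> by the upper rows, and the last row then
  leaves \<open>s * (d - b \<bullet> c) = 0\<close>.\<close>

lemma invertible_block_matrix_mat_1:
  fixes b c :: "real ^ 'n"
  assumes "d \<noteq> b \<bullet> c"
  shows "invertible (block_matrix (mat 1) b c d)"
proof -
  have "z = 0" if z: "block_matrix (mat 1) b c d *v z = 0" for z
  proof -
    define w where "w = (\<chi> k. z $ Some k)"
    define s where "s = z $ None"
    have row: "(\<Sum>j\<in>UNIV. block_matrix (mat 1) b c d $ i $ j * z $ j) = 0" for i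
      using arg_cong[OF z, of "\<lambda>v. v $ i"] by (simp add: matrix_vector_mult_def)
    have "b $ k * s + w $ k = 0" for k
    proof -
      have "(\<Sum>l\<in>UNIV. (mat 1 :: real ^ 'n ^ 'n) $ k $ l * w $ l) = (mat 1 *v w) $ k"
        by (simp only: matrix_vector_mult_def vec_lambda_beta)
      also have "\<dots> = w $ k" by simp
      finally show ?thesis
        using row[of "Some k"]
        by (simp add: sum_UNIV_option block_matrix_def s_def w_def)
    qed
    then have w: "w = (- s) *\<^sub>R b"
      by (simp add: vec_eq_iff add_eq_0_iff mult.commute)
    have "d * s + c \<bullet> w = 0"
      using row[of None]
      by (simp add: sum_UNIV_option block_matrix_def s_def w_def inner_vec_def)
    then have "s * (d - b \<bullet> c) = 0"
      by (simp add: w algebra_simps inner_commute)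
    then have "s = 0" using assms by simp
    then have "z $ i = 0" for i
      using w by (cases i) (simp_all add: s_def w_def vec_eq_iff)
    then show "z = 0" by (simp add: vec_eq_iff)
  qed
  then show ?thesis
    by (simp add: invertible_left_inverse matrix_left_invertible_ker)
qed

lemma fractional_linear_cone_map:
  fixes a p :: "real ^ 'n"
  assumes "a \<noteq> 0" "e \<noteq> 0"
  shows "fractional_linear_map {x. a \<bullet> (x - p) + e > 0} (cone_map a p e)"
proof -
  \<comment> \<open>The Schur complement is
    \<open>(e - a \<bullet> p) + p \<bullet> a = e\<close>.\<close>
  have "invertible (block_matrix (mat 1) (- p) a (e - a \<bullet> p))"
    using assms by (intro invertible_block_matrix_mat_1) (simp add: inner_commute)
  moreover have "frac_lin_domain a (e - a \<bullet> p) {x. a \<bullet> (x - p) + e > 0}"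
    using assms by (simp add: frac_lin_domain_def inner_diff_right inner_commute algebra_simps)
  moreover have "cone_map a p e x = (1 / (x \<bullet> a + (e - a \<bullet> p))) *\<^sub>R (mat 1 *v x + - p)" for x
    by (simp add: cone_map_def inner_diff_right inner_commute algebra_simps)
  ultimately show ?thesis
    unfolding fractional_linear_map_def by blast
qed

lemma continuous_on_cone_map:
  assumes "\<And>x. x \<in> S \<Longrightarrow> a \<bullet> (x - p) + e \<noteq> 0"
  shows "continuous_on S (cone_map a p e)"
  unfolding cone_map_def using assms by (intro continuous_intros) auto

text \<open>For \<open>e \<noteq> 0\<close> the value \<open>h / (h + e)\<close> determines the
  height \<open>h\<close>. Points with the same image thus have equal denominators, hence equal
  numerators.\<close>

lemma inj_on_cone_map:
  assumes "\<And>x. x \<in> S \<Longrightarrow> a \<bullet> (x - p) + e \<noteq> 0" and "e \<noteq> 0"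
  shows "inj_on (cone_map a p e) S"
proof (rule inj_onI)
  fix x y assume "x \<in> S" "y \<in> S" and eq: "cone_map a p e x = cone_map a p e y"
  then have nz: "a \<bullet> (x - p) + e \<noteq> 0" "a \<bullet> (y - p) + e \<noteq> 0"
    using assms by auto
  have "a \<bullet> (x - p) / (a \<bullet> (x - p) + e) = a \<bullet> (y - p) / (a \<bullet> (y - p) + e)"
    using arg_cong[OF eq, of "\<lambda>v. a \<bullet> v"] by (simp add: cone_map_def)
  then have "a \<bullet> (x - p) * e = a \<bullet> (y - p) * e"
    using nz by (simp add: frac_eq_eq algebra_simps)
  then have "a \<bullet> (x - p) = a \<bullet> (y - p)"
    using \<open>e \<noteq> 0\<close> by simp
  then show "x = y"
    using eq nz by (simp add: cone_map_def)
qed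

lemma cone_map_image_mono:
  assumes "convex A" "p \<in> A" "0 < e" "e \<le> 1"
  shows "cone_map a p 1 ` A \<subseteq> cone_map a p e ` A"
proof (rule image_subsetI)
  fix y assume "y \<in> A"
  define x where "x = (1 - e) *\<^sub>R p + e *\<^sub>R y"
  have "x \<in> A"
    unfolding x_def using assms \<open>y \<in> A\<close> by (intro convexD) auto
  moreover have "x - p = e *\<^sub>R (y - p)"
    by (simp add: x_def algebra_simps)
  \<comment> \<open>Numerator and denominator both scale by \<open>e\<close>. If
    \<open>a \<bullet> (y - p) + 1\<close> is 0, both images are 0 by the convention for
    division.\<close>
  then have "cone_map a p e x = (e / (e * (a \<bullet> (y - p) + 1))) *\<^sub>R (y - p)"
    by (simp add: cone_map_def distrib_left)
  then have "cone_map a p e x = cone_map a p 1 y"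
    using \<open>0 < e\<close> by (simp add: cone_map_def)
  ultimately show "cone_map a p 1 y \<in> cone_map a p e ` A"
    by (metis imageI)
qed

text \<open>By invariance of domain the image of the interior is open and nonempty, hence not
  negligible. Compactness of the whole image supplies measurability.\<close>

lemma emeasure_cone_map_pos:
  fixes A :: "(real ^ 'n) set"
  assumes "convex_body A" and ge: "\<And>x. x \<in> A \<Longrightarrow> a \<bullet> (x - p) \<ge> 0"
  shows "emeasure lebesgue (cone_map a p 1 ` A) > 0"
proof -
  let ?G = "cone_map a p 1"
  have nz: "a \<bullet> (x - p) + 1 \<noteq> 0" if "x \<in> A" for x
    using ge[OF that] by linarith
  have "open (?G ` interior A)"
    using nz interior_subset[of A]
    by (intro invariance_of_domain continuous_on_cone_map inj_on_cone_map) auto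
  then have "\<not> negligible (?G ` interior A)"
    using assms(1) by (simp add: open_not_negligible convex_body_def)
  then have "\<not> negligible (?G ` A)"
    using negligible_subset interior_subset image_mono by metis
  moreover have "compact (?G ` A)"
    using assms(1) nz
    by (intro compact_continuous_image continuous_on_cone_map) (auto simp: convex_body_def)
  ultimately show ?thesis
    by (metis lmeasurable_compact fmeasurableD negligible_iff_emeasure0 gr_zeroI)
qed

lemma emeasure_thin_slab_tendsto_0:
  fixes a :: "real ^ 'n" and C R :: real
  assumes "a \<noteq> 0" "C \<ge> 0"
  shows "(\<lambda>k. emeasure lebesgue
            (cball 0 R \<inter> {y. 1 - C / real (Suc k) \<le> a \<bullet> y \<and> a \<bullet> y \<le> 1})) \<longlonglongrightarrow> 0"
proof -
  define S where "S = (\<lambda>k. cball 0 R \<inter> {y. 1 - C / real (Suc k) \<le> a \<bullet> y \<and> a \<bullet> y \<le> 1})"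
  have "compact (S k)" for k
    unfolding S_def Collect_conj_eq
    by (intro compact_Int_closed closed_Int compact_cball closed_Collect_le continuous_intros)
  then have fm: "S k \<in> lmeasurable" for k
    by (rule lmeasurable_compact)
  have "decseq S"
  proof (rule decseq_SucI)
    fix k
    have "C / real (Suc (Suc k)) \<le> C / real (Suc k)"
      using \<open>C \<ge> 0\<close> by (intro divide_left_mono) auto
    then show "S (Suc k) \<subseteq> S k" by (auto simp: S_def)
  qed
  \<comment> \<open>Continuity from above needs finite measure, which intersecting with the ball
    guarantees.\<close>
  have "(\<lambda>k. emeasure lebesgue (S k)) \<longlonglongrightarrow> emeasure lebesgue (\<Inter>k. S k)"
  proof (rule Lim_emeasure_decseq)
    show "range S \<subseteq> sets lebesgue" using fmeasurableD[OF fm] by blast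
    show "emeasure lebesgue (S k) \<noteq> \<infinity>" for k using fmeasurableD2[OF fm] by simp
  qed fact
  moreover have "(\<Inter>k. S k) \<subseteq> {y. a \<bullet> y = 1}"
  proof
    fix y assume y: "y \<in> (\<Inter>k. S k)"
    have "(\<lambda>k. 1 - C / real (Suc k)) \<longlonglongrightarrow> 1 - 0"
      by (intro tendsto_diff tendsto_const lim_const_over_n[THEN LIMSEQ_Suc])
    moreover have "1 - C / real (Suc k) \<le> a \<bullet> y" for k
      using y by (auto simp: S_def)
    ultimately have "1 - 0 \<le> a \<bullet> y"
      by (intro LIMSEQ_le_const2) auto
    then show "y \<in> {y. a \<bullet> y = 1}" using y by (auto simp: S_def)
  qed
  then have "negligible (\<Inter>k. S k)"
    using negligible_hyperplane[of a 1] \<open>a \<noteq> 0\<close> negligible_subset by blast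
  then have "emeasure lebesgue (\<Inter>k. S k) = 0"
    by (simp add: negligible_iff_null_sets null_sets_def)
  ultimately show ?thesis by (simp add: S_def)
qed

text \<open>On \<open>B\<close> the denominator \<open>h + e\<close> is at least
  \<open>\<delta>\<close>, so the radius \<open>R / \<delta>\<close> does not depend on
  \<open>e\<close>, and the image height \<open>1 - e / (h + e)\<close> is within
  \<open>e / \<delta>\<close> of 1.\<close>

lemma cone_map_image_subset_slab:
  fixes B :: "(real ^ 'n) set"
  assumes R: "\<And>x. x \<in> B \<Longrightarrow> norm (x - p) \<le> R"
    and \<delta>: "\<delta> > 0" "\<And>x. x \<in> B \<Longrightarrow> \<delta> \<le> a \<bullet> (x - p)" and e: "e > 0"
  shows "cone_map a p e ` B \<subseteq> cball 0 (R / \<delta>) \<inter> {y. 1 - e / \<delta> \<le> a \<bullet> y \<and> a \<bullet> y \<le> 1}"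
proof (rule image_subsetI)
  fix x assume "x \<in> B"
  define h where "h = a \<bullet> (x - p)"
  have h: "\<delta> \<le> h" using \<delta>(2)[OF \<open>x \<in> B\<close>] by (simp add: h_def)
  have "norm (x - p) / (h + e) \<le> R / \<delta>"
    using R[OF \<open>x \<in> B\<close>] h \<delta>(1) e by (intro frac_le) (auto intro: order_trans[OF norm_ge_zero])
  then have "cone_map a p e x \<in> cball 0 (R / \<delta>)"
    using h \<delta>(1) e by (simp add: cone_map_def flip: h_def)
  moreover have "a \<bullet> cone_map a p e x = h / (h + e)"
    by (simp add: cone_map_def h_def)
  then have "a \<bullet> cone_map a p e x = 1 - e / (h + e)"
    using h \<delta>(1) e by (simp add: field_simps)
  moreover have "e / (h + e) \<le> e / \<delta>"
    using h \<delta>(1) e by (intro divide_left_mono) auto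
  ultimately show "cone_map a p e x
      \<in> cball 0 (R / \<delta>) \<inter> {y. 1 - e / \<delta> \<le> a \<bullet> y \<and> a \<bullet> y \<le> 1}"
    using h \<delta>(1) e by simp
qed

theorem theorem1p1:
  fixes A B :: "(real ^ 'n) set"
  assumes "convex_body A" and "convex_body B"
    and "\<And>D F. fractional_linear_map D F \<Longrightarrow> admissible D A B \<Longrightarrow>
           emeasure lebesgue (F ` A) \<le> emeasure lebesgue (F ` B)"
  shows "A \<subseteq> B"
proof (rule ccontr)
  assume "\<not> A \<subseteq> B"
  then obtain z where z: "z \<in> A" "z \<notin> B" by blast
  have A: "compact A" "convex A" and B: "compact B" "convex B" "B \<noteq> {}"
    using assms(1,2) by (auto simp: convex_body_def)
  obtain a \<beta> where a: "a \<bullet> z < \<beta>" "\<And>x. x \<in> B \<Longrightarrow> \<beta> < a \<bullet> x"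
    using separating_hyperplane_closed_point[of B z] z B compact_imp_closed by blast
  then have "a \<noteq> 0" using B(3) by fastforce
  \<comment> \<open>Replacing \<open>z\<close> by a minimiser over \<open>A\<close> makes all
    heights on \<open>A\<close> nonnegative, so \<open>A\<close> lies in the domain for every
    \<open>e > 0\<close>.\<close>
  have "\<exists>p\<in>A. \<forall>x\<in>A. a \<bullet> p \<le> a \<bullet> x"
    using A(1) z(1) by (intro continuous_attains_inf continuous_intros) auto
  then obtain p where p: "p \<in> A" "\<And>x. x \<in> A \<Longrightarrow> a \<bullet> p \<le> a \<bullet> x"
    by blast
  \<comment> \<open>The gap stays positive because
    \<open>a \<bullet> p \<le> a \<bullet> z < \<beta>\<close>.\<close>
  define \<delta> where "\<delta> = \<beta> - a \<bullet> p"
  have "\<delta> > 0" using p(2)[OF z(1)] a(1) by (simp add: \<delta>_def)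
  have hB: "\<delta> \<le> a \<bullet> (x - p)" if "x \<in> B" for x
    using a(2)[OF that] by (simp add: \<delta>_def inner_diff_right)
  have hA: "0 \<le> a \<bullet> (x - p)" if "x \<in> A" for x
    using p(2)[OF that] by (simp add: inner_diff_right)
  have "bounded ((\<lambda>x. x - p) ` B)"
    using B(1) by (intro compact_imp_bounded compact_continuous_image continuous_intros)
  then obtain R where R: "\<And>x. x \<in> B \<Longrightarrow> norm (x - p) \<le> R"
    by (auto simp: bounded_iff)
  define S where "S k = cball 0 (R / \<delta>) \<inter>
    {y. 1 - (1 / \<delta>) / real (Suc k) \<le> a \<bullet> y \<and> a \<bullet> y \<le> 1}" for k
  let ?G = "cone_map a p 1"
  \<comment> \<open>The left side is independent of \<open>k\<close>, so letting \<open>k\<close>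
    tend to infinity forces it to be 0.\<close>
  have "emeasure lebesgue (?G ` A) \<le> emeasure lebesgue (S k)" for k
  proof -
    \<comment> \<open>Using \<open>Suc k\<close> keeps \<open>e\<close> in (0, 1] even for
      \<open>k = 0\<close>, as the homothety about \<open>p\<close> with ratio \<open>e\<close> must
      map \<open>A\<close> into itself.\<close>
    define e where "e = 1 / real (Suc k)"
    have e: "0 < e" "e \<le> 1" by (auto simp: e_def)
    let ?F = "cone_map a p e" and ?D = "{x. a \<bullet> (x - p) + e > 0}"
    have adm: "admissible ?D A B"
      using hA hB \<open>\<delta> > 0\<close> e(1) by (fastforce simp: admissible_def)
    have "compact (?F ` A)"
      using A(1) adm
      by (intro compact_continuous_image continuous_on_cone_map) (auto simp: admissible_def)
    then have "?F ` A \<in> sets lebesgue"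
      by (intro fmeasurableD lmeasurable_compact)
    then have "emeasure lebesgue (?G ` A) \<le> emeasure lebesgue (?F ` A)"
      using A(2) p(1) e by (intro emeasure_mono cone_map_image_mono)
    also have "\<dots> \<le> emeasure lebesgue (?F ` B)"
      using adm e(1) \<open>a \<noteq> 0\<close> by (intro assms(3)[of ?D] fractional_linear_cone_map) auto
    also have "\<dots> \<le> emeasure lebesgue (S k)"
    proof (rule emeasure_mono)
      show "?F ` B \<subseteq> S k"
        using cone_map_image_subset_slab[OF R \<open>\<delta> > 0\<close> hB e(1)]
        by (simp add: S_def e_def mult.commute)
      have "closed (S k)"
        unfolding S_def Collect_conj_eq
        by (intro closed_Int closed_cball closed_Collect_le continuous_intros)
      then show "S k \<in> sets lebesgue" by simp
    qed
    finally show ?thesis .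
  qed
  moreover have "(\<lambda>k. emeasure lebesgue (S k)) \<longlonglongrightarrow> 0"
    unfolding S_def using \<open>a \<noteq> 0\<close> \<open>\<delta> > 0\<close> by (intro emeasure_thin_slab_tendsto_0) auto
  ultimately have "emeasure lebesgue (?G ` A) \<le> 0"
    by (intro LIMSEQ_le_const) auto
  then show False
    using emeasure_cone_map_pos[OF assms(1) hA] by (simp add: not_less)
qed

end
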